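(* Let $\mathfrak L$ and $\mathfrak L'$ be languages with value domains $\mathbb V$ and $\mathbb V'$, let $\mathcal T:\mathbb T_{\mathfrak L}\to\mathbb T_{\mathfrak L'}$ be a translation from $\mathfrak L$ into $\mathfrak L'$, and let $\sim$ and $\approx$ be equivalence relations on a class $\mathbb Z\supseteq\mathbb V\cup\mathbb V'$, both of which are congruences for $\mathcal T(\mathfrak L)$, such that $\sim$ is finer than $\approx$ (i.e. $p\sim q$ implies $p\approx q$ for all $p,q\in\mathbb Z$). If $\mathcal T$ is correct up to $\sim$, then $\mathcal T$ is also correct up to $\approx$.
   Context: Fix a set $\mathcal V$ of variables. A language $\mathfrak L$ consists of a set $\mathbb T_{\mathfrak L}$ of expressions built from variables in $\mathcal V$ by means of operators (and possibly recursion constructs), a domain of values $\mathbb V$, and a semantic mapping $[\![\cdot]\!]_{\mathfrak L}:\mathbb T_{\mathfrak L}\to((\mathcal V\to\mathbb V)\to\mathbb V)$; a function $\rho:\mathcal V\to\mathbb V$ is a valuation. For an equivalence $R$ on $\mathbb Z$, valuations $\eta,\rho:\mathcal V\to\mathbb Z$ satisfy $\eta\,R\,\rho$ if $\eta(X)\,R\,\rho(X)$ for all $X\in\mathcal V$. A translation $\mathcal T$ is correct up to $R$ if (i) for every $v\in\mathbb V$ there is $v'\in\mathbb V'$ with $v'\,R\,v$, and (ii) $[\![\mathcal T(E)]\!]_{\mathfrak L'}(\eta)\,R\,[\![E]\!]_{\mathfrak L}(\rho)$ for all $E\in\mathbb T_{\mathfrak L}$ and all valuations $\eta:\mathcal V\to\mathbb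 V'$, $\rho:\mathcal V\to\mathbb V$ with $\eta\,R\,\rho$. Let $\mathbb U^R:=\{v'\in\mathbb V'\mid\exists v\in\mathbb V.\ v'\,R\,v\}$. The equivalence $R$ is a congruence for $\mathcal T(\mathfrak L)$ if $[\![\mathcal T(E)]\!]_{\mathfrak L'}(\nu)\,R\,[\![\mathcal T(E)]\!]_{\mathfrak L'}(\eta)$ for every $E\in\mathbb T_{\mathfrak L}$ and all valuations $\nu,\eta:\mathcal V\to\mathbb U^R$ with $\nu\,R\,\eta$. *)

theory Defs
  imports Main "HOL-Library.FuncSet"
begin

text \<open>
  How expressions are built from variables by operators and recursion constructs is left abstract:
  a language may have any set of expressions. A valuation, as a function from the set of variables
  to a set of values, is an element of the extensional function space, and so is determined by its
  values on the variables.
\<close>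

record ('x, 'e, 'v) lang =
  exprs :: "'e set"
  vals  :: "'v set"
  sem   :: "'e \<Rightarrow> ('x \<Rightarrow> 'v) \<Rightarrow> 'v"

definition valuations :: "'x set \<Rightarrow> 'v set \<Rightarrow> ('x \<Rightarrow> 'v) set" where
  "valuations Vars D = (Vars \<rightarrow>\<^sub>E D)"

definition is_language :: "'x set \<Rightarrow> ('x, 'e, 'v) lang \<Rightarrow> bool" where
  "is_language Vars L \<longleftrightarrow> sem L \<in> exprs L \<rightarrow> (valuations Vars (vals L) \<rightarrow> vals L)"

definition is_translation ::
    "('x, 'e, 'v) lang \<Rightarrow> ('x, 'f, 'v) lang \<Rightarrow> ('e \<Rightarrow> 'f) \<Rightarrow> bool" where
  "is_translation L L' T \<longleftrightarrow> T \<in> exprs L \<rightarrow> exprs L'"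

definition val_rel :: "'x set \<Rightarrow> 'v rel \<Rightarrow> ('x \<Rightarrow> 'v) \<Rightarrow> ('x \<Rightarrow> 'v) \<Rightarrow> bool" where
  "val_rel Vars R \<eta> \<rho> \<longleftrightarrow> (\<forall>X\<in>Vars. (\<eta> X, \<rho> X) \<in> R)"

definition correct_up_to ::
    "'x set \<Rightarrow> ('x, 'e, 'v) lang \<Rightarrow> ('x, 'f, 'v) lang \<Rightarrow> ('e \<Rightarrow> 'f) \<Rightarrow> 'v rel \<Rightarrow> bool" where
  "correct_up_to Vars L L' T R \<longleftrightarrow>
     (\<forall>v\<in>vals L. \<exists>v'\<in>vals L'. (v', v) \<in> R) \<and>
     (\<forall>E\<in>exprs L. \<forall>\<eta>\<in>valuations Vars (vals L'). \<forall>\<rho>\<in>valuations Vars (vals L).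
        val_rel Vars R \<eta> \<rho> \<longrightarrow> (sem L' (T E) \<eta>, sem L E \<rho>) \<in> R)"

definition related_vals ::
    "('x, 'e, 'v) lang \<Rightarrow> ('x, 'f, 'v) lang \<Rightarrow> 'v rel \<Rightarrow> 'v set" where
  "related_vals L L' R = {v' \<in> vals L'. \<exists>v\<in>vals L. (v', v) \<in> R}"

definition congruence_for ::
    "'x set \<Rightarrow> ('x, 'e, 'v) lang \<Rightarrow> ('x, 'f, 'v) lang \<Rightarrow> ('e \<Rightarrow> 'f) \<Rightarrow> 'v rel \<Rightarrow> bool" where
  "congruence_for Vars L L' T R \<longleftrightarrow>
     (\<forall>E\<in>exprs L. \<forall>\<nu>\<in>valuations Vars (related_vals L L' R).
        \<forall>\<eta>\<in>valuations Vars (related_vals L L' R).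
          val_rel Vars R \<nu> \<eta> \<longrightarrow> (sem L' (T E) \<nu>, sem L' (T E) \<eta>) \<in> R)"

end

theory Submission imports Defs begin

text \<open>
  Given \<open>\<eta> \<approx> \<rho>\<close>, part (i) of correctness up to \<open>\<sim>\<close> yields a target valuation \<open>\<nu> \<sim> \<rho>\<close>, so that
  \<open>\<nu> \<approx> \<rho> \<approx> \<eta>\<close>. The congruence property of \<open>\<approx>\<close> and part (ii) for \<open>\<nu>\<close> then give
  \<open>\<lbrakk>\<T> E\<rbrakk> \<eta> \<approx> \<lbrakk>\<T> E\<rbrakk> \<nu> \<sim> \<lbrakk>E\<rbrakk> \<rho>\<close>.
\<close>

theorem theorem1:
  fixes Vars :: "'x set"
    and L :: "('x, 'e, 'v) lang"
    and L' :: "('x, 'f, 'v) lang"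
    and T :: "'e \<Rightarrow> 'f"
    and Z :: "'v set"
    and sim approx :: "'v rel"
  assumes "is_language Vars L" and "is_language Vars L'"
    and "is_translation L L' T"
    and "vals L \<union> vals L' \<subseteq> Z"
    and "equiv Z sim" and "equiv Z approx"
    and "congruence_for Vars L L' T sim"
    and "congruence_for Vars L L' T approx"
    and finer: "\<forall>p\<in>Z. \<forall>q\<in>Z. (p, q) \<in> sim \<longrightarrow> (p, q) \<in> approx"
    and "correct_up_to Vars L L' T sim"
  shows "correct_up_to Vars L L' T approx"
proof -
  have sym: "sym approx" and trans: "trans approx"
    using \<open>equiv Z approx\<close> by (auto simp: equiv_def)
  \<comment> \<open>\<open>sim\<close> is contained in \<open>approx\<close> only on
    \<open>Z\<close>, so each passage from one to the other has to place both values in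
    \<open>vals L'\<close> and \<open>vals L\<close>.\<close>
  have fine: "(v', v) \<in> approx" if "(v', v) \<in> sim" "v' \<in> vals L'" "v \<in> vals L" for v' v
    using that finer \<open>vals L \<union> vals L' \<subseteq> Z\<close> by blast
  have surj: "\<exists>v'\<in>vals L'. (v', v) \<in> sim" if "v \<in> vals L" for v
    using \<open>correct_up_to Vars L L' T sim\<close> that by (auto simp: correct_up_to_def)
  show ?thesis
    unfolding correct_up_to_def
  proof (intro conjI ballI impI)
    fix v assume "v \<in> vals L"
    with surj fine show "\<exists>v'\<in>vals L'. (v', v) \<in> approx" by blast
  next
    fix E \<eta> \<rho>
    assume E: "E \<in> exprs L"
      and \<eta>: "\<eta> \<in> valuations Vars (vals L')" and \<rho>: "\<rho> \<in> valuations Vars (vals L)"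
      and rel: "val_rel Vars approx \<eta> \<rho>"
    have \<eta>_val: "\<eta> X \<in> vals L'" and \<rho>_val: "\<rho> X \<in> vals L" if "X \<in> Vars" for X
      using \<eta> \<rho> that by (auto simp: valuations_def)
    have rel_at: "(\<eta> X, \<rho> X) \<in> approx" if "X \<in> Vars" for X
      using rel that by (simp add: val_rel_def)
    have "\<forall>X\<in>Vars. \<exists>v'. v' \<in> vals L' \<and> (v', \<rho> X) \<in> sim"
      using surj \<rho>_val by blast
    then obtain f where f: "\<And>X. X \<in> Vars \<Longrightarrow> f X \<in> vals L' \<and> (f X, \<rho> X) \<in> sim"
      by metis
    \<comment> \<open>Choice gives \<open>f\<close> with the right values on \<open>Vars\<close>
      only; restricting it makes it extensional, as a valuation must be.\<close>
    define \<nu> where "\<nu> = restrict f Vars"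
    have \<nu>_val: "\<nu> X \<in> vals L'" and \<nu>_sim: "(\<nu> X, \<rho> X) \<in> sim" if "X \<in> Vars" for X
      using f that by (auto simp: \<nu>_def)
    have \<nu>_ext: "\<nu> \<in> extensional Vars"
      by (simp add: \<nu>_def)
    have \<nu>: "\<nu> \<in> valuations Vars (vals L')"
      using \<nu>_val \<nu>_ext by (auto simp: valuations_def PiE_iff)
    have \<nu>_approx: "(\<nu> X, \<rho> X) \<in> approx" if "X \<in> Vars" for X
      using that fine \<nu>_sim \<nu>_val \<rho>_val by blast
    \<comment> \<open>The congruence property speaks only of valuations into
      \<open>related_vals\<close>. For \<eta> and \<nu> alike, \<rho> X is the source value that
      witnesses membership at X.\<close>
    have "\<eta> \<in> valuations Vars (related_vals L L' approx)"
      using \<eta> \<rho>_val rel_at by (auto simp: valuations_def PiE_iff related_vals_def)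
    moreover have "\<nu> \<in> valuations Vars (related_vals L L' approx)"
      using \<nu>_ext \<nu>_val \<rho>_val \<nu>_approx by (auto simp: valuations_def PiE_iff related_vals_def)
    moreover have "val_rel Vars approx \<eta> \<nu>"
      unfolding val_rel_def
      using rel_at \<nu>_approx symD[OF sym] transD[OF trans] by blast
    ultimately have cong: "(sem L' (T E) \<eta>, sem L' (T E) \<nu>) \<in> approx"
      using \<open>congruence_for Vars L L' T approx\<close> E by (auto simp: congruence_for_def)
    \<comment> \<open>Correctness up to \<open>sim\<close> applies to \<nu>, which is
      \<open>sim\<close>-related to \<rho>; for \<eta> only \<open>approx\<close> is known.\<close>
    have "(sem L' (T E) \<nu>, sem L E \<rho>) \<in> sim"
      using \<open>correct_up_to Vars L L' T sim\<close> E \<nu> \<rho> \<nu>_sim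
      by (auto simp: correct_up_to_def val_rel_def)
    \<comment> \<open>Both meanings are values of their languages, hence lie in \<open>Z\<close>,
      where \<open>sim\<close> can be weakened to \<open>approx\<close>.\<close>
    moreover have "sem L E \<rho> \<in> vals L"
      using \<open>is_language Vars L\<close> E \<rho> by (auto simp: is_language_def)
    moreover have "sem L' (T E) \<nu> \<in> vals L'"
      using \<open>is_language Vars L'\<close> \<open>is_translation L L' T\<close> E \<nu>
      by (auto simp: is_language_def is_translation_def dest!: funcset_mem)
    ultimately have "(sem L' (T E) \<nu>, sem L E \<rho>) \<in> approx"
      using fine by blast
    with cong show "(sem L' (T E) \<eta>, sem L E \<rho>) \<in> approx"
      by (rule transD[OF trans])
  qed
qed

end
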